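(* For any infinite set $\Gamma$, the Banach space $c_0(\Gamma)$ has a strictly convex renorming (i.e. an equivalent strictly convex norm) which is almost square and has a 1-unconditional basis.
   Context: All spaces are real. A norm $\|\cdot\|$ is strictly convex if $\frac12\|x+y\|=\|x\|=\|y\|$ implies $x=y$. A Banach space $X$ (or its norm) is almost square if for every finite subset $x_1,\dots,x_n$ of the unit sphere $S_X$ and every $\varepsilon>0$ there is $y\in S_X$ with $\|x_i+y\|\le1+\varepsilon$ for all $i=1,\dots,n$. A family $(e_\alpha)_{\alpha\in A}$ ($A$ non-empty, possibly uncountable) is an unconditional basis of a Banach space $X$ if for every $x\in X$ there is a unique family of reals $(a_\alpha)$ with $x=\sum_{\alpha\in A} a_\alpha e_\alpha$, in the sense that for every $\varepsilon>0$ there is a finite $F\subset A$ with $\|x-\sum_{\alpha\in G}a_\alpha e_\alpha\|<\varepsilon$ for every finite $G\supset F$. It is 1-unconditional if moreover $\|\sum_{\alpha\in F}b_\alpha e_\alpha\|\le\|\sum_{\alpha\in F}a_\alpha e_\alpha\|$ for all finite $F\subset A$ and all reals with $|b_\alpha|\le|a_\alpha|$ for $\alpha\in F$. *)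

theory Defs
  imports "HOL-Analysis.Analysis" "HOL-Library.Function_Algebras"
begin

section \<open>Pointwise real vector space structure on functions\<close>

instantiation "fun" :: (type, real_vector) real_vector
begin

definition scaleR_fun :: "real \<Rightarrow> ('a \<Rightarrow> 'b) \<Rightarrow> 'a \<Rightarrow> 'b"
  where "scaleR_fun r f = (\<lambda>x. r *\<^sub>R f x)"

instance
  by standard (auto simp: scaleR_fun_def plus_fun_def scaleR_add_left scaleR_add_right)

end

section \<open>Norms on a subspace\<close>

text \<open>
  A normed space is given by a linear subspace \<open>V\<close> of an ambient real vector space and a
  function \<open>N\<close> that is a norm on \<open>V\<close>; the values of \<open>N\<close> outside \<open>V\<close> are irrelevant. This
  makes it possible to put several norms on the same space.
\<close>

definition norm_on :: "'v::real_vector set \<Rightarrow> ('v \<Rightarrow> real) \<Rightarrow> bool"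
  where "norm_on V N \<longleftrightarrow>
    subspace V \<and>
    (\<forall>x\<in>V. 0 \<le> N x) \<and>
    (\<forall>x\<in>V. N x = 0 \<longleftrightarrow> x = 0) \<and>
    (\<forall>x\<in>V. \<forall>r. N (r *\<^sub>R x) = \<bar>r\<bar> * N x) \<and>
    (\<forall>x\<in>V. \<forall>y\<in>V. N (x + y) \<le> N x + N y)"

definition equivalent_norms_on ::
    "'v::real_vector set \<Rightarrow> ('v \<Rightarrow> real) \<Rightarrow> ('v \<Rightarrow> real) \<Rightarrow> bool"
  where "equivalent_norms_on V N M \<longleftrightarrow>
    norm_on V N \<and> norm_on V M \<and>
    (\<exists>c>0. \<exists>C>0. \<forall>x\<in>V. c * M x \<le> N x \<and> N x \<le> C * M x)"

definition strictly_convex_norm_on :: "'v::real_vector set \<Rightarrow> ('v \<Rightarrow> real) \<Rightarrow> bool"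
  where "strictly_convex_norm_on V N \<longleftrightarrow>
    (\<forall>x\<in>V. \<forall>y\<in>V. (1/2) * N (x + y) = N x \<and> N x = N y \<longrightarrow> x = y)"

definition unit_sphere_on :: "'v::real_vector set \<Rightarrow> ('v \<Rightarrow> real) \<Rightarrow> 'v set"
  where "unit_sphere_on V N = {x \<in> V. N x = 1}"

definition almost_square_on :: "'v::real_vector set \<Rightarrow> ('v \<Rightarrow> real) \<Rightarrow> bool"
  where "almost_square_on V N \<longleftrightarrow>
    (\<forall>S. finite S \<and> S \<subseteq> unit_sphere_on V N \<longrightarrow>
      (\<forall>\<epsilon>>0. \<exists>y\<in>unit_sphere_on V N. \<forall>x\<in>S. N (x + y) \<le> 1 + \<epsilon>))"

section \<open>Unconditional bases\<close>

definition unconditional_sum_on ::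
    "('v::real_vector \<Rightarrow> real) \<Rightarrow> 'i set \<Rightarrow> ('i \<Rightarrow> 'v) \<Rightarrow> ('i \<Rightarrow> real) \<Rightarrow> 'v \<Rightarrow> bool"
  where "unconditional_sum_on N A e a x \<longleftrightarrow>
    (\<forall>\<epsilon>>0. \<exists>F. finite F \<and> F \<subseteq> A \<and>
      (\<forall>G. finite G \<and> F \<subseteq> G \<and> G \<subseteq> A \<longrightarrow> N (x - (\<Sum>i\<in>G. a i *\<^sub>R e i)) < \<epsilon>))"

text \<open>
  Families of reals indexed by \<open>A\<close> are represented by extensional functions, so that the
  uniqueness below is uniqueness of the coefficients on \<open>A\<close>.
\<close>

definition unconditional_basis_on ::
    "'v::real_vector set \<Rightarrow> ('v \<Rightarrow> real) \<Rightarrow> 'i set \<Rightarrow> ('i \<Rightarrow> 'v) \<Rightarrow> bool"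
  where "unconditional_basis_on V N A e \<longleftrightarrow>
    A \<noteq> {} \<and> e ` A \<subseteq> V \<and>
    (\<forall>x\<in>V. \<exists>!a. a \<in> A \<rightarrow>\<^sub>E (UNIV :: real set) \<and> unconditional_sum_on N A e a x)"

definition one_unconditional_basis_on ::
    "'v::real_vector set \<Rightarrow> ('v \<Rightarrow> real) \<Rightarrow> 'i set \<Rightarrow> ('i \<Rightarrow> 'v) \<Rightarrow> bool"
  where "one_unconditional_basis_on V N A e \<longleftrightarrow>
    unconditional_basis_on V N A e \<and>
    (\<forall>F a b. finite F \<and> F \<subseteq> A \<and> (\<forall>i\<in>F. \<bar>b i\<bar> \<le> \<bar>a i\<bar>) \<longrightarrow>
      N (\<Sum>i\<in>F. b i *\<^sub>R e i) \<le> N (\<Sum>i\<in>F. a i *\<^sub>R e i))"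

section \<open>The space \<open>c\<^sub>0(\<Gamma>)\<close>\<close>

text \<open>
  A function on \<open>\<Gamma>\<close> is represented by its extension by \<open>0\<close> to the whole type.
\<close>

definition c0 :: "'a set \<Rightarrow> ('a \<Rightarrow> real) set"
  where "c0 \<Gamma> = {f. (\<forall>\<gamma>. \<gamma> \<notin> \<Gamma> \<longrightarrow> f \<gamma> = 0) \<and> (\<forall>\<epsilon>>0. finite {\<gamma>\<in>\<Gamma>. \<bar>f \<gamma>\<bar> \<ge> \<epsilon>})}"

definition c0_norm :: "'a set \<Rightarrow> ('a \<Rightarrow> real) \<Rightarrow> real"
  where "c0_norm \<Gamma> f = (SUP \<gamma>\<in>\<Gamma>. \<bar>f \<gamma>\<bar>)"

lemma subspace_c0: "subspace (c0 \<Gamma>)"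
proof (rule subspaceI)
  show "0 \<in> c0 \<Gamma>"
    by (auto simp: c0_def zero_fun_def)
next
  fix f g :: "'a \<Rightarrow> real"
  assume fg: "f \<in> c0 \<Gamma>" "g \<in> c0 \<Gamma>"
  have "finite {\<gamma>\<in>\<Gamma>. \<bar>f \<gamma> + g \<gamma>\<bar> \<ge> \<epsilon>}" if "\<epsilon> > 0" for \<epsilon> :: real
  proof (rule finite_subset)
    show "{\<gamma>\<in>\<Gamma>. \<bar>f \<gamma> + g \<gamma>\<bar> \<ge> \<epsilon>} \<subseteq> {\<gamma>\<in>\<Gamma>. \<bar>f \<gamma>\<bar> \<ge> \<epsilon>/2} \<union> {\<gamma>\<in>\<Gamma>. \<bar>g \<gamma>\<bar> \<ge> \<epsilon>/2}"
      by auto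
    show "finite ({\<gamma>\<in>\<Gamma>. \<bar>f \<gamma>\<bar> \<ge> \<epsilon>/2} \<union> {\<gamma>\<in>\<Gamma>. \<bar>g \<gamma>\<bar> \<ge> \<epsilon>/2})"
      using fg half_gt_zero[OF that] unfolding c0_def by blast
  qed
  with fg show "f + g \<in> c0 \<Gamma>"
    by (auto simp: c0_def plus_fun_def)
next
  fix r :: real and f :: "'a \<Rightarrow> real"
  assume f: "f \<in> c0 \<Gamma>"
  have "finite {\<gamma>\<in>\<Gamma>. \<bar>r * f \<gamma>\<bar> \<ge> \<epsilon>}" if "\<epsilon> > 0" for \<epsilon> :: real
  proof (cases "r = 0")
    case False
    then have "{\<gamma>\<in>\<Gamma>. \<bar>r * f \<gamma>\<bar> \<ge> \<epsilon>} = {\<gamma>\<in>\<Gamma>. \<bar>f \<gamma>\<bar> \<ge> \<epsilon> / \<bar>r\<bar>}"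
      by (auto simp: abs_mult field_simps)
    moreover have "\<epsilon> / \<bar>r\<bar> > 0"
      using False that by simp
    ultimately show ?thesis
      using f unfolding c0_def by simp
  qed (use that in simp)
  with f show "r *\<^sub>R f \<in> c0 \<Gamma>"
    by (auto simp: c0_def scaleR_fun_def)
qed

lemma c0_bdd_above:
  assumes "f \<in> c0 \<Gamma>"
  shows "bdd_above ((\<lambda>\<gamma>. \<bar>f \<gamma>\<bar>) ` \<Gamma>)"
proof -
  let ?S = "{\<gamma>\<in>\<Gamma>. \<bar>f \<gamma>\<bar> \<ge> 1}"
  have "finite ?S"
    using assms by (auto simp: c0_def)
  then have "bdd_above ((\<lambda>\<gamma>. \<bar>f \<gamma>\<bar>) ` ?S)"
    by simp
  moreover have "bdd_above ((\<lambda>\<gamma>. \<bar>f \<gamma>\<bar>) ` (\<Gamma> - ?S))"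
    by (rule bdd_aboveI[where M = 1]) auto
  ultimately have "bdd_above ((\<lambda>\<gamma>. \<bar>f \<gamma>\<bar>) ` ?S \<union> (\<lambda>\<gamma>. \<bar>f \<gamma>\<bar>) ` (\<Gamma> - ?S))"
    by simp
  moreover have "(\<lambda>\<gamma>. \<bar>f \<gamma>\<bar>) ` \<Gamma> = (\<lambda>\<gamma>. \<bar>f \<gamma>\<bar>) ` ?S \<union> (\<lambda>\<gamma>. \<bar>f \<gamma>\<bar>) ` (\<Gamma> - ?S)"
    by blast
  ultimately show ?thesis
    by simp
qed

lemma norm_on_c0:
  assumes "\<Gamma> \<noteq> {}"
  shows "norm_on (c0 \<Gamma>) (c0_norm \<Gamma>)"
proof -
  have upper: "\<bar>f \<gamma>\<bar> \<le> c0_norm \<Gamma> f" if "f \<in> c0 \<Gamma>" "\<gamma> \<in> \<Gamma>" for f \<gamma>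
    unfolding c0_norm_def using that by (intro cSUP_upper c0_bdd_above)
  have least: "c0_norm \<Gamma> f \<le> M" if "\<And>\<gamma>. \<gamma> \<in> \<Gamma> \<Longrightarrow> \<bar>f \<gamma>\<bar> \<le> M" for f M
    unfolding c0_norm_def using assms that by (rule cSUP_least)
  have nonneg: "0 \<le> c0_norm \<Gamma> f" if "f \<in> c0 \<Gamma>" for f
    using assms upper[OF that] by (meson abs_ge_zero ex_in_conv order_trans)
  have zero: "c0_norm \<Gamma> f = 0 \<longleftrightarrow> f = 0" if f: "f \<in> c0 \<Gamma>" for f
  proof
    assume 0: "c0_norm \<Gamma> f = 0"
    have "f \<gamma> = 0" for \<gamma>
      using upper[OF f, of \<gamma>] f 0 by (cases "\<gamma> \<in> \<Gamma>") (auto simp: c0_def)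
    then show "f = 0"
      by (simp add: fun_eq_iff)
  next
    assume "f = 0"
    then show "c0_norm \<Gamma> f = 0"
      using assms by (simp add: c0_norm_def)
  qed
  have le: "c0_norm \<Gamma> (r *\<^sub>R f) \<le> \<bar>r\<bar> * c0_norm \<Gamma> f" if "f \<in> c0 \<Gamma>" for r f
    by (rule least) (auto simp: scaleR_fun_def abs_mult intro!: mult_left_mono upper that)
  have scale: "c0_norm \<Gamma> (r *\<^sub>R f) = \<bar>r\<bar> * c0_norm \<Gamma> f" if f: "f \<in> c0 \<Gamma>" for r f
  proof (cases "r = 0")
    case True
    then show ?thesis
      using zero[OF subspace_0[OF subspace_c0]] by simp
  next
    case False
    have "c0_norm \<Gamma> (inverse r *\<^sub>R (r *\<^sub>R f)) \<le> \<bar>inverse r\<bar> * c0_norm \<Gamma> (r *\<^sub>R f)"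
      by (intro le subspace_scale subspace_c0 f)
    with False have "\<bar>r\<bar> * c0_norm \<Gamma> f \<le> c0_norm \<Gamma> (r *\<^sub>R f)"
      by (simp add: field_simps)
    with le[OF f, of r] show ?thesis
      by simp
  qed
  have add: "c0_norm \<Gamma> (f + g) \<le> c0_norm \<Gamma> f + c0_norm \<Gamma> g"
    if "f \<in> c0 \<Gamma>" "g \<in> c0 \<Gamma>" for f g
  proof (rule least)
    fix \<gamma> assume "\<gamma> \<in> \<Gamma>"
    then show "\<bar>(f + g) \<gamma>\<bar> \<le> c0_norm \<Gamma> f + c0_norm \<Gamma> g"
      using upper[OF that(1), of \<gamma>] upper[OF that(2), of \<gamma>] by simp
  qed
  show ?thesis
    unfolding norm_on_def using subspace_c0 nonneg zero scale add by blast
qed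

end

theory Submission
  imports Defs
begin

text \<open>
  The norm is the Luxemburg norm of a convex modular on \<open>c0 \<Gamma>\<close>. Choose an injective sequence
  \<open>g\<close> in \<open>\<Gamma>\<close>, let \<open>\<Delta> = \<Gamma> - range g\<close>, and put
  \<open>\<Phi> x = (\<Sum>n. x (g n) ^ (2 * (n + 1)) + (1/4) ^ (n + 1) * S (n + 1) x)\<close>, where \<open>S k x\<close> is the
  supremum of \<open>\<Sum>\<gamma>\<in>A. (x \<gamma>)\<^sup>2\<close> over the sets \<open>A \<subseteq> \<Delta>\<close> with at most \<open>k\<close> elements.
  Because null families are eventually small along \<open>g\<close>, \<open>\<Phi>\<close> is finite on the whole space, so it is
  continuous along every line; hence the norm of \<open>x\<close> is at most \<open>1\<close>, or less than \<open>1\<close>,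
  exactly if \<open>\<Phi> x\<close> is. A supremum norm of at most \<open>1/2\<close> forces \<open>\<Phi> x \<le> 1\<close>, which in turn forces a supremum
  norm of at most \<open>2\<close>, so the new norm is equivalent to the old one.

  Almost squareness comes from the first summand, the modular of a Nakano space with exponents
  tending to infinity. Let \<open>x\<close> have norm \<open>1\<close> and divide the sum of \<open>x\<close> and the unit vector at
  \<open>g n\<close> by \<open>1 + \<epsilon>\<close>. The part of the modular due to \<open>x\<close> drops to at most \<open>1 / (1 + \<epsilon>)\<close>, while the
  coordinate at \<open>g n\<close> contributes a \<open>2 * (n + 1)\<close>-th power of a number bounded away from \<open>1\<close>,
  which is below \<open>\<epsilon> / (1 + \<epsilon>)\<close> for large \<open>n\<close>.

  Strict convexity of the norm follows from that of \<open>\<Phi>\<close>. Coordinates in the range of \<open>g\<close> are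
  controlled by even powers. The second summand, a relative of Day's norm, takes care of
  the possibly uncountable set \<open>\<Delta>\<close> (lemma \<open>top_squares_strict\<close>): if \<open>x \<delta> \<noteq> 0\<close> and exactly \<open>k\<close>
  coordinates with index in \<open>\<Delta>\<close> are at least as large as \<open>\<bar>x \<delta>\<bar>\<close>, then sets \<open>A\<close> that nearly attain \<open>S k x\<close> must
  contain \<open>\<delta>\<close>, so a difference between \<open>x \<delta>\<close> and \<open>y \<delta>\<close> is visible in \<open>S k\<close>.

  Finally \<open>\<Phi> x\<close> is monotone in the absolute values of the coordinates, so the norm is a lattice
  norm, and for every lattice norm equivalent to the supremum norm the unit vectors are a
  1-unconditional basis.
\<close>

section \<open>Even powers\<close>

lemma even_power_convex:
  fixes a b u v :: real
  assumes "0 \<le> u" "0 \<le> v" "u + v = 1"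
  shows "(u * a + v * b) ^ (2 * m) \<le> u * a ^ (2 * m) + v * b ^ (2 * m)"
  using convex_power_even[of "2 * m"] assms unfolding convex_on_def by simp

text \<open>
  The power \<open>2 * m\<close> is the increasing convex function \<open>t ^ m\<close> on the nonnegative reals applied to
  the square, and the square alone already gives the strict inequality.
\<close>

lemma even_power_strictly_convex:
  fixes a b :: real
  assumes "a \<noteq> b" "0 < m"
  shows "((1/2) * (a + b)) ^ (2 * m) < (a ^ (2 * m) + b ^ (2 * m)) / 2"
proof -
  have convex: "convex_on {0::real..} (\<lambda>x. x ^ m)"
    by (cases "even m") (auto intro: convex_power_odd convex_on_subset[OF convex_power_even])
  have "0 < (a - b)\<^sup>2" using assms by simp
  then have "((1/2) * (a + b))\<^sup>2 < (a\<^sup>2 + b\<^sup>2) / 2"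
    by (simp add: power2_eq_square algebra_simps)
  then have "(((1/2) * (a + b))\<^sup>2) ^ m < ((a\<^sup>2 + b\<^sup>2) / 2) ^ m"
    using assms by (intro power_strict_mono) auto
  also have "\<dots> = ((1/2) *\<^sub>R a\<^sup>2 + (1/2) *\<^sub>R b\<^sup>2) ^ m"
    by (simp add: add_divide_distrib)
  also have "\<dots> \<le> (1/2) * (a\<^sup>2) ^ m + (1/2) * (b\<^sup>2) ^ m"
    using convex_onD[OF convex, of "1/2" "a\<^sup>2" "b\<^sup>2"] by simp
  finally show ?thesis by (simp add: power_mult add_divide_distrib)
qed

lemma even_power_le:
  fixes t :: real
  assumes "\<bar>t\<bar> \<le> 1/2"
  shows "t ^ (2 * m) \<le> (1/4) ^ m"
proof -
  have "t ^ (2 * m) \<le> (1/2) ^ (2 * m)"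
    using assms by (intro power_mono_even) auto
  then show ?thesis by (simp add: power_mult power2_eq_square)
qed

section \<open>Sums of the largest squares\<close>

definition top_squares :: "'a set \<Rightarrow> nat \<Rightarrow> ('a \<Rightarrow> real) \<Rightarrow> real"
  where "top_squares \<Delta> k x =
    (SUP A\<in>{A. finite A \<and> A \<subseteq> \<Delta> \<and> card A \<le> k}. \<Sum>\<gamma>\<in>A. (x \<gamma>)\<^sup>2)"

lemma top_squares_le:
  assumes "\<And>A. finite A \<Longrightarrow> A \<subseteq> \<Delta> \<Longrightarrow> card A \<le> k \<Longrightarrow> (\<Sum>\<gamma>\<in>A. (x \<gamma>)\<^sup>2) \<le> M"
  shows "top_squares \<Delta> k x \<le> M"
proof -
  have "{} \<in> {A. finite A \<and> A \<subseteq> \<Delta> \<and> card A \<le> k}" by simp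
  then show ?thesis
    unfolding top_squares_def using assms by (intro cSUP_least) auto
qed

lemma sum_squares_le:
  fixes x :: "'a \<Rightarrow> real"
  assumes "\<And>\<gamma>. \<gamma> \<in> A \<Longrightarrow> \<bar>x \<gamma>\<bar> \<le> B" "card A \<le> k"
  shows "(\<Sum>\<gamma>\<in>A. (x \<gamma>)\<^sup>2) \<le> real k * B\<^sup>2"
proof -
  have "(\<Sum>\<gamma>\<in>A. (x \<gamma>)\<^sup>2) \<le> real (card A) * B\<^sup>2"
    using assms(1) by (intro sum_bounded_above) (metis abs_ge_zero power2_abs power_mono)
  also have "\<dots> \<le> real k * B\<^sup>2"
    using assms(2) by (intro mult_right_mono) auto
  finally show ?thesis .
qed

lemma sum_le_top_squares:
  assumes "bounded (x ` \<Delta>)" "finite A" "A \<subseteq> \<Delta>" "card A \<le> k"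
  shows "(\<Sum>\<gamma>\<in>A. (x \<gamma>)\<^sup>2) \<le> top_squares \<Delta> k x"
proof -
  obtain B where "\<And>\<gamma>. \<gamma> \<in> \<Delta> \<Longrightarrow> \<bar>x \<gamma>\<bar> \<le> B"
    using assms(1) by (auto simp: bounded_iff)
  then have "bdd_above ((\<lambda>A. \<Sum>\<gamma>\<in>A. (x \<gamma>)\<^sup>2) ` {A. finite A \<and> A \<subseteq> \<Delta> \<and> card A \<le> k})"
    by (intro bdd_aboveI2[where M = "real k * B\<^sup>2"] sum_squares_le) auto
  then show ?thesis
    unfolding top_squares_def using assms by (intro cSUP_upper) auto
qed

lemma top_squares_le_bound:
  assumes "\<And>\<gamma>. \<gamma> \<in> \<Delta> \<Longrightarrow> \<bar>x \<gamma>\<bar> \<le> B"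
  shows "top_squares \<Delta> k x \<le> real k * B\<^sup>2"
  using assms by (intro top_squares_le sum_squares_le) auto

lemma top_squares_nonneg: "bounded (x ` \<Delta>) \<Longrightarrow> 0 \<le> top_squares \<Delta> k x"
  using sum_le_top_squares[of x \<Delta> "{}"] by simp

lemma top_squares_cong:
  assumes "\<And>\<gamma>. \<gamma> \<in> \<Delta> \<Longrightarrow> x \<gamma> = y \<gamma>"
  shows "top_squares \<Delta> k x = top_squares \<Delta> k y"
  unfolding top_squares_def using assms by (intro SUP_cong sum.cong) auto

lemma top_squares_mono:
  assumes "bounded (y ` \<Delta>)" "\<And>\<gamma>. \<gamma> \<in> \<Delta> \<Longrightarrow> \<bar>x \<gamma>\<bar> \<le> \<bar>y \<gamma>\<bar>"
  shows "top_squares \<Delta> k x \<le> top_squares \<Delta> k y"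
proof (rule top_squares_le)
  fix A assume A: "finite A" "A \<subseteq> \<Delta>" "card A \<le> k"
  have "(\<Sum>\<gamma>\<in>A. (x \<gamma>)\<^sup>2) \<le> (\<Sum>\<gamma>\<in>A. (y \<gamma>)\<^sup>2)"
    using A assms(2) by (intro sum_mono) (auto simp: abs_le_square_iff)
  also have "\<dots> \<le> top_squares \<Delta> k y"
    using assms(1) A by (rule sum_le_top_squares)
  finally show "(\<Sum>\<gamma>\<in>A. (x \<gamma>)\<^sup>2) \<le> top_squares \<Delta> k y" .
qed

lemma top_squares_convex:
  assumes "bounded (x ` \<Delta>)" "bounded (y ` \<Delta>)" "0 \<le> u" "0 \<le> v" "u + v = 1"
  shows "top_squares \<Delta> k (u *\<^sub>R x + v *\<^sub>R y) \<le> u * top_squares \<Delta> k x + v * top_squares \<Delta> k y"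
proof (rule top_squares_le)
  fix A assume A: "finite A" "A \<subseteq> \<Delta>" "card A \<le> k"
  have "(\<Sum>\<gamma>\<in>A. ((u *\<^sub>R x + v *\<^sub>R y) \<gamma>)\<^sup>2) \<le> (\<Sum>\<gamma>\<in>A. u * (x \<gamma>)\<^sup>2 + v * (y \<gamma>)\<^sup>2)"
    using even_power_convex[of u v _ _ 1] assms(3-) by (intro sum_mono) (simp add: scaleR_fun_def)
  also have "\<dots> = u * (\<Sum>\<gamma>\<in>A. (x \<gamma>)\<^sup>2) + v * (\<Sum>\<gamma>\<in>A. (y \<gamma>)\<^sup>2)"
    by (simp add: sum.distrib sum_distrib_left)
  also have "\<dots> \<le> u * top_squares \<Delta> k x + v * top_squares \<Delta> k y"
    using A assms by (intro add_mono mult_left_mono sum_le_top_squares) auto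
  finally show "(\<Sum>\<gamma>\<in>A. ((u *\<^sub>R x + v *\<^sub>R y) \<gamma>)\<^sup>2) \<le> \<dots>" .
qed

text \<open>
  Let \<open>Suc m\<close> be the number of coordinates at least as large as \<open>\<bar>x \<delta>\<bar>\<close>. A set of at most \<open>Suc m\<close>
  indices that misses \<open>\<delta>\<close> either has room for \<open>\<delta>\<close>, or contains an index with a smaller
  coordinate that can be exchanged for \<open>\<delta>\<close>. Since only finitely many coordinates exceed half of
  \<open>\<bar>x \<delta>\<bar>\<close>, the smaller coordinates stay below some \<open>b < \<bar>x \<delta>\<bar>\<close>, so the gain has a bound \<open>c\<close> that
  is the same for all these sets.
\<close>

lemma top_squares_gap:
  assumes bounded: "bounded (x ` \<Delta>)"
    and small: "\<And>e. 0 < e \<Longrightarrow> finite {\<gamma>\<in>\<Delta>. e \<le> \<bar>x \<gamma>\<bar>}"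
    and \<delta>: "\<delta> \<in> \<Delta>" "x \<delta> \<noteq> 0"
  obtains m c where "0 < c"
    "\<And>A. finite A \<Longrightarrow> A \<subseteq> \<Delta> \<Longrightarrow> card A \<le> Suc m \<Longrightarrow> \<delta> \<notin> A \<Longrightarrow>
      (\<Sum>\<gamma>\<in>A. (x \<gamma>)\<^sup>2) + c \<le> top_squares \<Delta> (Suc m) x"
proof -
  define a where "a = \<bar>x \<delta>\<bar>"
  have a: "0 < a" using \<delta> by (simp add: a_def)
  define H where "H = {\<gamma>\<in>\<Delta>. a \<le> \<bar>x \<gamma>\<bar>}"
  have H: "finite H" "\<delta> \<in> H" using small[OF a] \<delta> by (auto simp: H_def a_def)
  \<comment> \<open>\<open>H\<close> contains \<open>\<delta>\<close>, so its cardinality is a successor.\<close>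
  define m where "m = card H - 1"
  have m: "card H = Suc m"
    using H card_gt_0_iff[of H] by (auto simp: m_def)
  define T where "T = {\<gamma>\<in>\<Delta>. a/2 \<le> \<bar>x \<gamma>\<bar>}"
  have T: "finite T" unfolding T_def using small[of "a/2"] a by simp
  \<comment> \<open>Including \<open>a/2\<close> covers the indices outside \<open>T\<close> and keeps the maximum defined if \<open>T = H\<close>.\<close>
  define b where "b = Max (insert (a/2) ((\<lambda>\<gamma>. \<bar>x \<gamma>\<bar>) ` (T - H)))"
  have b_less: "b < a"
    unfolding b_def using T a by (subst Max_less_iff) (auto simp: T_def H_def)
  have b_ge: "a/2 \<le> b"
    unfolding b_def using T by (intro Max_ge) auto
  have b: "\<bar>x \<gamma>\<bar> \<le> b" if "\<gamma> \<in> \<Delta> - H" for \<gamma>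
  proof (cases "\<gamma> \<in> T")
    case True
    then show ?thesis unfolding b_def using T that by (intro Max_ge) auto
  next
    case False
    then show ?thesis using that b_ge by (simp add: T_def)
  qed
  define c where "c = a\<^sup>2 - b\<^sup>2"
  have c: "0 < c" using b_less b_ge a by (simp add: c_def power_strict_mono)
  show thesis
  proof (rule that[OF c])
    fix A assume A: "finite A" "A \<subseteq> \<Delta>" "card A \<le> Suc m" "\<delta> \<notin> A"
    show "(\<Sum>\<gamma>\<in>A. (x \<gamma>)\<^sup>2) + c \<le> top_squares \<Delta> (Suc m) x"
    proof (cases "A \<subseteq> H")
      case True
      then have "card A < Suc m"
        using H A m by (metis psubsetI psubset_card_mono)
      then have "(\<Sum>\<gamma>\<in>insert \<delta> A. (x \<gamma>)\<^sup>2) \<le> top_squares \<Delta> (Suc m) x"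
        using A \<delta> by (intro sum_le_top_squares bounded) auto
      moreover have "(\<Sum>\<gamma>\<in>insert \<delta> A. (x \<gamma>)\<^sup>2) = a\<^sup>2 + (\<Sum>\<gamma>\<in>A. (x \<gamma>)\<^sup>2)"
        using A by (simp add: a_def)
      ultimately show ?thesis
        using zero_le_power2[of b] unfolding c_def by linarith
    next
      case False
      then obtain \<eta> where \<eta>: "\<eta> \<in> A" "\<eta> \<notin> H" by blast
      have "card (insert \<delta> (A - {\<eta>})) = Suc (card (A - {\<eta>}))"
        using A by (intro card_insert_disjoint) auto
      also have "\<dots> = card A"
        using A(1) \<eta>(1) by (rule card_Suc_Diff1)
      finally have "card (insert \<delta> (A - {\<eta>})) = card A" .
      then have "(\<Sum>\<gamma>\<in>insert \<delta> (A - {\<eta>}). (x \<gamma>)\<^sup>2) \<le> top_squares \<Delta> (Suc m) x"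
        using A \<delta> by (intro sum_le_top_squares bounded) auto
      moreover have "(\<Sum>\<gamma>\<in>insert \<delta> (A - {\<eta>}). (x \<gamma>)\<^sup>2) = a\<^sup>2 + (\<Sum>\<gamma>\<in>A. (x \<gamma>)\<^sup>2) - (x \<eta>)\<^sup>2"
        using A \<eta> by (simp add: a_def sum_diff1)
      moreover have "(x \<eta>)\<^sup>2 \<le> b\<^sup>2"
        using b[of \<eta>] \<eta> A by (metis DiffI abs_ge_zero power2_abs power_mono subsetD)
      ultimately show ?thesis by (simp add: c_def)
    qed
  qed
qed

text \<open>
  By the parallelogram law, the squares of the midpoint over a set \<open>A\<close> fall short of the average
  for \<open>x\<close> and \<open>y\<close> by a quarter of the squares of \<open>x - y\<close>. If \<open>\<delta> \<in> A\<close>, this deficit is at least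
  \<open>(x \<delta> - y \<delta>)\<^sup>2 / 4\<close>; if \<open>\<delta> \<notin> A\<close>, then \<open>A\<close> is far from optimal for \<open>x\<close> by the previous lemma.
  Either way the loss is bounded below uniformly in \<open>A\<close>, and hence survives the supremum.
\<close>

lemma top_squares_strict:
  assumes x: "bounded (x ` \<Delta>)" "\<And>e. 0 < e \<Longrightarrow> finite {\<gamma>\<in>\<Delta>. e \<le> \<bar>x \<gamma>\<bar>}"
    and y: "bounded (y ` \<Delta>)" "\<And>e. 0 < e \<Longrightarrow> finite {\<gamma>\<in>\<Delta>. e \<le> \<bar>y \<gamma>\<bar>}"
    and \<delta>: "\<delta> \<in> \<Delta>" "x \<delta> \<noteq> y \<delta>"
  shows "\<exists>m. top_squares \<Delta> (Suc m) ((1/2) *\<^sub>R (x + y))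
    < (top_squares \<Delta> (Suc m) x + top_squares \<Delta> (Suc m) y) / 2"
proof -
  \<comment> \<open>At least one of \<open>x \<delta>\<close>, \<open>y \<delta>\<close> is nonzero; by symmetry it may be assumed to be \<open>x \<delta>\<close>.\<close>
  have *: "\<exists>m. top_squares \<Delta> (Suc m) ((1/2) *\<^sub>R (x + y))
      < (top_squares \<Delta> (Suc m) x + top_squares \<Delta> (Suc m) y) / 2"
    if x: "bounded (x ` \<Delta>)" "\<And>e. 0 < e \<Longrightarrow> finite {\<gamma>\<in>\<Delta>. e \<le> \<bar>x \<gamma>\<bar>}"
      and y: "bounded (y ` \<Delta>)" and \<delta>: "x \<delta> \<noteq> y \<delta>" "x \<delta> \<noteq> 0"
    for x y
  proof -
    obtain m c where c: "0 < c" and gap: "\<And>A. finite A \<Longrightarrow> A \<subseteq> \<Delta> \<Longrightarrow> card A \<le> Suc m \<Longrightarrow> \<delta> \<notin> A \<Longrightarrow>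
        (\<Sum>\<gamma>\<in>A. (x \<gamma>)\<^sup>2) + c \<le> top_squares \<Delta> (Suc m) x"
      using top_squares_gap[OF x \<open>\<delta> \<in> \<Delta>\<close> \<delta>(2)] by blast
    define d where "d = min (c / 2) ((x \<delta> - y \<delta>)\<^sup>2 / 4)"
    have d: "0 < d" "d \<le> c / 2" "d \<le> (x \<delta> - y \<delta>)\<^sup>2 / 4"
      using c \<delta> by (auto simp: d_def)
    have "top_squares \<Delta> (Suc m) ((1/2) *\<^sub>R (x + y))
        \<le> (top_squares \<Delta> (Suc m) x + top_squares \<Delta> (Suc m) y) / 2 - d"
    proof (rule top_squares_le)
      fix A assume A: "finite A" "A \<subseteq> \<Delta>" "card A \<le> Suc m"
      define D where "D = (\<Sum>\<gamma>\<in>A. (x \<gamma> - y \<gamma>)\<^sup>2)"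
      have "(\<Sum>\<gamma>\<in>A. (((1/2) *\<^sub>R (x + y)) \<gamma>)\<^sup>2)
          = (\<Sum>\<gamma>\<in>A. (1/2) * (x \<gamma>)\<^sup>2 + (1/2) * (y \<gamma>)\<^sup>2 - (1/4) * (x \<gamma> - y \<gamma>)\<^sup>2)"
        by (intro sum.cong) (auto simp: scaleR_fun_def power2_eq_square algebra_simps)
      also have "\<dots> = (1/2) * (\<Sum>\<gamma>\<in>A. (x \<gamma>)\<^sup>2) + (1/2) * (\<Sum>\<gamma>\<in>A. (y \<gamma>)\<^sup>2) - (1/4) * D"
        by (simp add: D_def sum.distrib sum_subtractf sum_distrib_left)
      finally have eq: "(\<Sum>\<gamma>\<in>A. (((1/2) *\<^sub>R (x + y)) \<gamma>)\<^sup>2) = \<dots>" .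
      have xA: "(\<Sum>\<gamma>\<in>A. (x \<gamma>)\<^sup>2) \<le> top_squares \<Delta> (Suc m) x"
        and yA: "(\<Sum>\<gamma>\<in>A. (y \<gamma>)\<^sup>2) \<le> top_squares \<Delta> (Suc m) y"
        using A x y by (auto intro: sum_le_top_squares)
      show "(\<Sum>\<gamma>\<in>A. (((1/2) *\<^sub>R (x + y)) \<gamma>)\<^sup>2)
          \<le> (top_squares \<Delta> (Suc m) x + top_squares \<Delta> (Suc m) y) / 2 - d"
      proof (cases "\<delta> \<in> A")
        case True
        then have "(x \<delta> - y \<delta>)\<^sup>2 \<le> D"
          unfolding D_def using A by (intro member_le_sum) auto
        then show ?thesis unfolding eq using xA yA d(3) by argo
      next
        case False
        moreover have "0 \<le> D" by (simp add: D_def sum_nonneg)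
        ultimately show ?thesis
          unfolding eq using gap[OF A] yA d(2) by argo
      qed
    qed
    with d show ?thesis by (intro exI[of _ m]) argo
  qed
  show ?thesis
  proof (cases "x \<delta> = 0")
    case False
    then show ?thesis using *[OF x y(1)] \<delta> by blast
  next
    case True
    then show ?thesis using *[OF y x(1)] \<delta> by (simp add: add.commute)
  qed
qed

section \<open>The Luxemburg norm of a convex modular\<close>

locale convex_modular =
  fixes V :: "'v::real_vector set" and \<Phi> :: "'v \<Rightarrow> real"
  assumes subspace: "subspace V"
    and convex: "convex_on V \<Phi>"
    and zero: "\<Phi> 0 = 0"
    and even: "x \<in> V \<Longrightarrow> \<Phi> (- x) = \<Phi> x"
    and separating: "x \<in> V \<Longrightarrow> x \<noteq> 0 \<Longrightarrow> \<exists>r>0. 1 < \<Phi> (r *\<^sub>R x)"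
begin

definition luxemburg :: "'v \<Rightarrow> real"
  where "luxemburg x = Inf {r. 0 < r \<and> \<Phi> (x /\<^sub>R r) \<le> 1}"

lemma scale_mem: "x \<in> V \<Longrightarrow> r *\<^sub>R x \<in> V"
  using subspace by (rule subspace_scale)

lemma add_mem: "x \<in> V \<Longrightarrow> y \<in> V \<Longrightarrow> x + y \<in> V"
  using subspace by (rule subspace_add)

lemma convexD:
  assumes "x \<in> V" "y \<in> V" "0 \<le> u" "0 \<le> v" "u + v = 1"
  shows "\<Phi> (u *\<^sub>R x + v *\<^sub>R y) \<le> u * \<Phi> x + v * \<Phi> y"
  using convex assms unfolding convex_on_def by blast

lemma scale_le:
  assumes "x \<in> V" "0 \<le> t" "t \<le> 1"
  shows "\<Phi> (t *\<^sub>R x) \<le> t * \<Phi> x"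
  using convexD[of x 0 t "1 - t"] assms subspace_0[OF subspace] zero by simp

lemma nonneg:
  assumes "x \<in> V"
  shows "0 \<le> \<Phi> x"
proof -
  have "\<Phi> ((1/2) *\<^sub>R x + (1/2) *\<^sub>R (- x)) \<le> 1/2 * \<Phi> x + 1/2 * \<Phi> (- x)"
    using assms subspace_neg[OF subspace] by (intro convexD) auto
  then show ?thesis
    using assms zero even by simp
qed

lemma admissible_nonempty:
  assumes "x \<in> V"
  shows "\<exists>r>0. \<Phi> (x /\<^sub>R r) \<le> 1"
proof (intro exI conjI)
  let ?r = "1 + \<Phi> x"
  show "0 < ?r" using nonneg[OF assms] by simp
  have "\<Phi> (x /\<^sub>R ?r) \<le> inverse ?r * \<Phi> x"
    using nonneg[OF assms] by (intro scale_le assms) (auto simp: field_simps)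
  also have "\<dots> \<le> 1"
    using nonneg[OF assms] by (simp add: field_simps)
  finally show "\<Phi> (x /\<^sub>R ?r) \<le> 1" .
qed

lemma luxemburg_le:
  assumes "0 < r" "\<Phi> (x /\<^sub>R r) \<le> 1"
  shows "luxemburg x \<le> r"
  unfolding luxemburg_def using assms
  by (intro cInf_lower bdd_belowI[where m = 0]) auto

lemma luxemburg_nonneg:
  assumes "x \<in> V"
  shows "0 \<le> luxemburg x"
  unfolding luxemburg_def using admissible_nonempty[OF assms]
  by (intro cInf_greatest) auto

lemma luxemburg_lessD:
  assumes "x \<in> V" "luxemburg x < r"
  shows "\<Phi> (x /\<^sub>R r) < 1"
proof -
  have "{r. 0 < r \<and> \<Phi> (x /\<^sub>R r) \<le> 1} \<noteq> {}"
    using admissible_nonempty[OF assms(1)] by blast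
  from cInf_lessD[OF this] assms(2)
  obtain s where s: "0 < s" "\<Phi> (x /\<^sub>R s) \<le> 1" "s < r"
    unfolding luxemburg_def by auto
  have "\<Phi> (x /\<^sub>R r) = \<Phi> ((s / r) *\<^sub>R (x /\<^sub>R s))"
    using s by (simp add: field_simps)
  also have "\<dots> \<le> (s / r) * \<Phi> (x /\<^sub>R s)"
    using s assms by (intro scale_le scale_mem) auto
  also have "\<dots> \<le> (s / r) * 1"
    using s by (intro mult_left_mono) auto
  also have "\<dots> < 1" using s by simp
  finally show ?thesis .
qed

text \<open>
  This and its counterpart \<open>luxemburg_le_iff\<close> for the closed ball express that the finite convex function \<open>\<Phi>\<close> is continuous along
  rays. Here \<open>(1 + d) w\<close> is a convex combination of \<open>w\<close> and \<open>2 w\<close>, so \<open>\<Phi>\<close> stays below \<open>1\<close> for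
  a little longer on the ray through \<open>w\<close>.
\<close>

lemma less_imp_luxemburg_less:
  assumes "x \<in> V" "0 < r" "\<Phi> (x /\<^sub>R r) < 1"
  shows "luxemburg x < r"
proof -
  define w where "w = x /\<^sub>R r"
  have w: "w \<in> V" "2 *\<^sub>R w \<in> V" "\<Phi> w < 1"
    using assms by (auto simp: w_def scale_mem)
  \<comment> \<open>Small enough that \<open>d * \<Phi> (2 *\<^sub>R w)\<close> fits into the room left between \<open>\<Phi> w\<close> and \<open>1\<close>.\<close>
  define d where "d = (1 - \<Phi> w) / (1 + \<Phi> (2 *\<^sub>R w))"
  have d: "0 < d" "d \<le> 1" "d * \<Phi> (2 *\<^sub>R w) \<le> 1 - \<Phi> w"
    using w nonneg[OF w(1)] nonneg[OF w(2)] by (auto simp: d_def field_simps)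
  have "(1 + d) *\<^sub>R w = (1 - d) *\<^sub>R w + d *\<^sub>R (2 *\<^sub>R w)"
    by (simp flip: scaleR_add_left)
  then have "\<Phi> ((1 + d) *\<^sub>R w) = \<Phi> ((1 - d) *\<^sub>R w + d *\<^sub>R (2 *\<^sub>R w))"
    by simp
  also have "\<dots> \<le> (1 - d) * \<Phi> w + d * \<Phi> (2 *\<^sub>R w)"
    using d w by (intro convexD) auto
  also have "\<dots> \<le> \<Phi> w + d * \<Phi> (2 *\<^sub>R w)"
    using d nonneg[OF w(1)] by (simp add: algebra_simps)
  also have "\<dots> \<le> 1" using d by simp
  finally have "\<Phi> (x /\<^sub>R (r / (1 + d))) \<le> 1"
    using d assms by (simp add: w_def field_simps)
  then have "luxemburg x \<le> r / (1 + d)"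
    using d assms by (intro luxemburg_le) auto
  also have "\<dots> < r" using d assms by (simp add: field_simps)
  finally show ?thesis .
qed

lemma luxemburg_less_iff:
  assumes "x \<in> V" "0 < r"
  shows "luxemburg x < r \<longleftrightarrow> \<Phi> (x /\<^sub>R r) < 1"
  using luxemburg_lessD less_imp_luxemburg_less assms by blast

lemma luxemburg_le_iff:
  assumes "x \<in> V" "0 < r"
  shows "luxemburg x \<le> r \<longleftrightarrow> \<Phi> (x /\<^sub>R r) \<le> 1"
proof
  assume le: "luxemburg x \<le> r"
  define w where "w = x /\<^sub>R r"
  have w: "w \<in> V" "2 *\<^sub>R w \<in> V"
    using assms by (auto simp: w_def scale_mem)
  have "\<Phi> w \<le> 1 + e" if "0 < e" for e
  proof -
    define d where "d = min 1 (e / (1 + \<Phi> (2 *\<^sub>R w)))"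
    have d: "0 < d" "d \<le> 1"
      using that nonneg[OF w(2)] by (auto simp: d_def)
    have "d \<le> e / (1 + \<Phi> (2 *\<^sub>R w))" by (simp add: d_def)
    then have de: "d * \<Phi> (2 *\<^sub>R w) \<le> e"
      using nonneg[OF w(2)] d by (simp add: field_simps)
    let ?t = "1 / (1 + d)"
    have t: "0 < ?t" "?t < 1" using d by auto
    have "luxemburg x < r * (1 + d)"
      using le mult_pos_pos[OF assms(2) d(1)] by (simp add: distrib_left)
    then have "\<Phi> (x /\<^sub>R (r * (1 + d))) < 1"
      by (rule luxemburg_lessD[OF assms(1)])
    then have 1: "\<Phi> (?t *\<^sub>R w) < 1"
      by (simp add: w_def field_simps)
    \<comment> \<open>\<open>w\<close> lies between the shrunk vector \<open>w / (1 + d)\<close>, where \<open>\<Phi>\<close> is below \<open>1\<close>, and \<open>2 w\<close>, whose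
      weight vanishes with \<open>d\<close>.\<close>
    have "w = (1 - d / (1 + 2 * d)) *\<^sub>R (?t *\<^sub>R w) + (d / (1 + 2 * d)) *\<^sub>R (2 *\<^sub>R w)"
    proof -
      have "(1 - d / (1 + 2 * d)) * ?t + (d / (1 + 2 * d)) * 2 = 1"
        using d by (simp add: field_simps)
      then show ?thesis
        by (metis scaleR_add_left scaleR_one scaleR_scaleR)
    qed
    then have "\<Phi> w \<le> (1 - d / (1 + 2 * d)) * \<Phi> (?t *\<^sub>R w) + (d / (1 + 2 * d)) * \<Phi> (2 *\<^sub>R w)"
      using convexD[of "?t *\<^sub>R w" "2 *\<^sub>R w" "1 - d / (1 + 2 * d)" "d / (1 + 2 * d)"]
        w d scale_mem[OF w(1)] by simp
    also have "\<dots> \<le> 1 * 1 + d * \<Phi> (2 *\<^sub>R w)"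
      using d 1 nonneg[OF w(2)] nonneg[OF scale_mem[OF w(1)], of ?t]
      by (intro add_mono mult_mono mult_right_mono) (auto simp: field_simps)
    finally show ?thesis using de by simp
  qed
  then have "\<Phi> w \<le> 1" by (rule field_le_epsilon)
  then show "\<Phi> (x /\<^sub>R r) \<le> 1" by (simp add: w_def)
qed (use assms luxemburg_le in blast)

lemma luxemburg_zero: "luxemburg 0 = 0"
proof (rule antisym)
  show "luxemburg 0 \<le> 0"
    by (rule field_le_epsilon) (auto intro: luxemburg_le simp: zero)
qed (rule luxemburg_nonneg[OF subspace_0[OF subspace]])

lemma luxemburg_scale_pos:
  assumes x: "x \<in> V" and t: "0 < t"
  shows "luxemburg (t *\<^sub>R x) = t * luxemburg x"
proof -
  have iff: "luxemburg (t *\<^sub>R x) < r \<longleftrightarrow> luxemburg x < r / t" if "0 < r" for r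
    using luxemburg_less_iff[OF scale_mem[OF x, of t] that] luxemburg_less_iff[OF x, of "r / t"] that t
    by (simp add: field_simps)
  show ?thesis
  proof (rule ccontr)
    assume "luxemburg (t *\<^sub>R x) \<noteq> t * luxemburg x"
    then consider "luxemburg (t *\<^sub>R x) < t * luxemburg x" | "t * luxemburg x < luxemburg (t *\<^sub>R x)"
      by linarith
    then show False
    proof cases
      case 1
      then have "0 < t * luxemburg x"
        using luxemburg_nonneg[OF scale_mem[OF x]] by (rule order_le_less_trans[rotated])
      with iff[of "t * luxemburg x"] 1 t show False by simp
    next
      case 2
      moreover have "0 \<le> t * luxemburg x"
        using luxemburg_nonneg[OF x] t by simp
      ultimately have "0 < luxemburg (t *\<^sub>R x)" by simp
      with iff[of "luxemburg (t *\<^sub>R x)"] 2 t show False by (simp add: field_simps)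
    qed
  qed
qed

lemma luxemburg_scale:
  assumes x: "x \<in> V"
  shows "luxemburg (t *\<^sub>R x) = \<bar>t\<bar> * luxemburg x"
proof -
  have minus: "luxemburg (- y) = luxemburg y" if "y \<in> V" for y
    unfolding luxemburg_def using even[OF scale_mem[OF that]] by simp
  consider "0 < t" | "t = 0" | "t < 0" by linarith
  then show ?thesis
  proof cases
    case 1
    then show ?thesis using luxemburg_scale_pos[OF x] by simp
  next
    case 2
    then show ?thesis using luxemburg_zero by simp
  next
    case 3
    then show ?thesis
      using luxemburg_scale_pos[OF x, of "- t"] minus[OF scale_mem[OF x, of t]] by simp
  qed
qed

lemma luxemburg_triangle:
  assumes "x \<in> V" "y \<in> V"
  shows "luxemburg (x + y) \<le> luxemburg x + luxemburg y"
proof (rule field_le_epsilon)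
  fix e :: real assume "0 < e"
  define r s where "r = luxemburg x + e/2" and "s = luxemburg y + e/2"
  have rs: "0 < r" "0 < s" "luxemburg x < r" "luxemburg y < s"
    using \<open>0 < e\<close> luxemburg_nonneg[OF assms(1)] luxemburg_nonneg[OF assms(2)]
    by (auto simp: r_def s_def)
  \<comment> \<open>The unit ball is convex: \<open>(x + y) / (r + s)\<close> is a convex combination of \<open>x / r\<close> and \<open>y / s\<close>.\<close>
  have "\<Phi> ((x + y) /\<^sub>R (r + s)) = \<Phi> ((r / (r + s)) *\<^sub>R (x /\<^sub>R r) + (s / (r + s)) *\<^sub>R (y /\<^sub>R s))"
    using rs by (simp add: scaleR_add_right field_simps)
  also have "\<dots> \<le> (r / (r + s)) * \<Phi> (x /\<^sub>R r) + (s / (r + s)) * \<Phi> (y /\<^sub>R s)"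
    using rs assms by (intro convexD scale_mem) (auto simp flip: add_divide_distrib)
  also have "\<dots> \<le> (r / (r + s)) * 1 + (s / (r + s)) * 1"
    using rs luxemburg_lessD[OF assms(1) rs(3)] luxemburg_lessD[OF assms(2) rs(4)]
    by (intro add_mono mult_left_mono) auto
  also have "\<dots> = 1" using rs by (simp flip: add_divide_distrib)
  finally have "luxemburg (x + y) \<le> r + s"
    using rs by (intro luxemburg_le) auto
  then show "luxemburg (x + y) \<le> luxemburg x + luxemburg y + e"
    by (simp add: r_def s_def)
qed

lemma luxemburg_eq_0_iff:
  assumes "x \<in> V"
  shows "luxemburg x = 0 \<longleftrightarrow> x = 0"
proof
  assume 0: "luxemburg x = 0"
  show "x = 0"
  proof (rule ccontr)
    assume "x \<noteq> 0"
    then obtain r where "0 < r" "1 < \<Phi> (r *\<^sub>R x)"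
      using separating[OF assms] by blast
    then show False
      using luxemburg_lessD[OF assms, of "1 / r"] 0 by (simp add: inverse_eq_divide)
  qed
qed (simp add: luxemburg_zero)

theorem norm_on_luxemburg: "norm_on V luxemburg"
  unfolding norm_on_def
  by (intro conjI ballI allI subspace luxemburg_nonneg luxemburg_eq_0_iff luxemburg_scale
      luxemburg_triangle)

text \<open>
  Two distinct points \<open>x\<close> and \<open>y\<close> of equal norm satisfy \<open>\<Phi> x \<le> 1\<close> and \<open>\<Phi> y \<le> 1\<close> after scaling to
  norm \<open>1\<close>. By hypothesis \<open>\<Phi>\<close> is then below \<open>1\<close> at their midpoint, which therefore lies in the
  open unit ball.
\<close>

theorem strictly_convex_luxemburg:
  assumes strict: "\<And>x y. x \<in> V \<Longrightarrow> y \<in> V \<Longrightarrow> x \<noteq> y \<Longrightarrow>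
      \<Phi> ((1/2) *\<^sub>R (x + y)) < (\<Phi> x + \<Phi> y) / 2"
  shows "strictly_convex_norm_on V luxemburg"
  unfolding strictly_convex_norm_on_def
proof (intro ballI impI)
  fix x y
  assume xy: "x \<in> V" "y \<in> V"
    and eq: "(1/2) * luxemburg (x + y) = luxemburg x \<and> luxemburg x = luxemburg y"
  define r where "r = luxemburg x"
  show "x = y"
  proof (cases "r = 0")
    case True
    then show ?thesis using eq xy luxemburg_eq_0_iff by (simp add: r_def)
  next
    case False
    then have r: "0 < r" using luxemburg_nonneg[OF xy(1)] by (simp add: r_def)
    show ?thesis
    proof (rule ccontr)
      assume "x \<noteq> y"
      then have "\<Phi> ((1/2) *\<^sub>R (x /\<^sub>R r + y /\<^sub>R r)) < (\<Phi> (x /\<^sub>R r) + \<Phi> (y /\<^sub>R r)) / 2"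
        using xy r by (intro strict scale_mem) auto
      also have "\<dots> \<le> 1"
        using luxemburg_le_iff[OF xy(1) r] luxemburg_le_iff[OF xy(2) r] eq by (simp add: r_def)
      finally have "\<Phi> (((1/2) *\<^sub>R (x + y)) /\<^sub>R r) < 1"
        by (simp add: scaleR_add_right mult.commute)
      then have "luxemburg ((1/2) *\<^sub>R (x + y)) < r"
        using luxemburg_less_iff[OF scale_mem[OF add_mem[OF xy]] r] by simp
      then show False
        using eq luxemburg_scale[OF add_mem[OF xy], of "1/2"] by (simp add: r_def)
    qed
  qed
qed

end

section \<open>A modular on \<open>c0 \<Gamma>\<close> and its norm\<close>

lemma abs_le_c0_norm:
  assumes "x \<in> c0 \<Gamma>" "\<gamma> \<in> \<Gamma>"
  shows "\<bar>x \<gamma>\<bar> \<le> c0_norm \<Gamma> x"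
  unfolding c0_norm_def using assms by (intro cSUP_upper c0_bdd_above)

lemma c0_norm_le:
  assumes "\<Gamma> \<noteq> {}" "\<And>\<gamma>. \<gamma> \<in> \<Gamma> \<Longrightarrow> \<bar>x \<gamma>\<bar> \<le> M"
  shows "c0_norm \<Gamma> x \<le> M"
  unfolding c0_norm_def using assms by (rule cSUP_least)

lemma finite_c0_large: "x \<in> c0 \<Gamma> \<Longrightarrow> 0 < e \<Longrightarrow> finite {\<gamma>\<in>\<Gamma>. e \<le> \<bar>x \<gamma>\<bar>}"
  by (auto simp: c0_def)

lemma c0_vanishes: "x \<in> c0 \<Gamma> \<Longrightarrow> \<gamma> \<notin> \<Gamma> \<Longrightarrow> x \<gamma> = 0"
  by (auto simp: c0_def)

lemma finite_support_mem_c0: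
  assumes "finite F" "F \<subseteq> \<Gamma>" "\<And>\<gamma>. \<gamma> \<notin> F \<Longrightarrow> x \<gamma> = 0"
  shows "x \<in> c0 \<Gamma>"
proof -
  have "finite {\<gamma>\<in>\<Gamma>. e \<le> \<bar>x \<gamma>\<bar>}" if "0 < e" for e
    using assms(1) by (rule rev_finite_subset) (use assms(3) that in force)
  then show ?thesis using assms by (auto simp: c0_def)
qed

lemma unit_vector_mem_c0: "\<gamma> \<in> \<Gamma> \<Longrightarrow> indicator {\<gamma>} \<in> c0 \<Gamma>"
  by (rule finite_support_mem_c0[of "{\<gamma>}"]) auto

locale c0_with_sequence =
  fixes \<Gamma> :: "'a set" and g :: "nat \<Rightarrow> 'a"
  assumes inj: "inj g" and range: "range g \<subseteq> \<Gamma>"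
begin

definition rest :: "'a set"
  where "rest = \<Gamma> - range g"

text \<open>
  The summand for the set \<open>rest\<close> leaves out the indices \<open>g n\<close>: with them, adding the unit vector at
  \<open>g n\<close> would raise it by an amount that does not tend to \<open>0\<close> as \<open>n\<close> grows, and almost squareness
  would be lost. The weights \<open>(1/4) ^ Suc n\<close> outweigh the growth of \<open>top_squares\<close>, which is at
  most linear in the number of squares.
\<close>

definition modular_term :: "nat \<Rightarrow> ('a \<Rightarrow> real) \<Rightarrow> real"
  where "modular_term n x = x (g n) ^ (2 * Suc n) + (1/4) ^ Suc n * top_squares rest (Suc n) x"

definition modular :: "('a \<Rightarrow> real) \<Rightarrow> real"
  where "modular x = (\<Sum>n. modular_term n x)"

lemma g_mem: "g n \<in> \<Gamma>"
  using range by blast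

lemma nonempty: "\<Gamma> \<noteq> {}"
  using g_mem by blast

lemma g_not_rest: "g n \<notin> rest"
  by (simp add: rest_def)

lemma bounded_rest:
  assumes "x \<in> c0 \<Gamma>"
  shows "bounded (x ` rest)"
  using abs_le_c0_norm[OF assms] by (auto simp: bounded_iff rest_def)

lemma finite_rest_large:
  assumes "x \<in> c0 \<Gamma>" "0 < e"
  shows "finite {\<gamma>\<in>rest. e \<le> \<bar>x \<gamma>\<bar>}"
  using finite_c0_large[OF assms] by (rule rev_finite_subset) (auto simp: rest_def)

lemma eventually_small:
  assumes "x \<in> c0 \<Gamma>" "0 < e"
  shows "\<forall>\<^sub>F n in sequentially. \<bar>x (g n)\<bar> < e"
proof -
  have "finite (g -` {\<gamma>\<in>\<Gamma>. e \<le> \<bar>x \<gamma>\<bar>})"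
    using finite_c0_large[OF assms] inj by (rule finite_vimageI)
  also have "g -` {\<gamma>\<in>\<Gamma>. e \<le> \<bar>x \<gamma>\<bar>} = {n. \<not> \<bar>x (g n)\<bar> < e}"
    using g_mem by auto
  finally show ?thesis
    by (simp add: eventually_cofinite flip: cofinite_eq_sequentially)
qed

lemma weighted_top_squares_le:
  assumes "\<And>\<gamma>. \<gamma> \<in> rest \<Longrightarrow> \<bar>x \<gamma>\<bar> \<le> B"
  shows "(1/4) ^ Suc n * top_squares rest (Suc n) x \<le> (1/2) ^ Suc n * B\<^sup>2"
proof -
  have "real (Suc n) \<le> 2 ^ Suc n"
    using of_nat_less_two_power[of "Suc n"] by (metis less_imp_le)
  have "(1/4) ^ Suc n * top_squares rest (Suc n) x \<le> (1/4) ^ Suc n * (real (Suc n) * B\<^sup>2)"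
    using assms by (intro mult_left_mono top_squares_le_bound) auto
  also have "\<dots> \<le> (1/4) ^ Suc n * (2 ^ Suc n * B\<^sup>2)"
    using \<open>real (Suc n) \<le> 2 ^ Suc n\<close> by (intro mult_left_mono mult_right_mono) auto
  also have "\<dots> = (1/2) ^ Suc n * B\<^sup>2"
    by (simp only: mult.assoc[symmetric] power_mult_distrib[symmetric]) simp
  finally show ?thesis .
qed

lemma weighted_top_squares_nonneg:
  "x \<in> c0 \<Gamma> \<Longrightarrow> 0 \<le> (1/4) ^ Suc n * top_squares rest (Suc n) x"
  using bounded_rest top_squares_nonneg by (intro mult_nonneg_nonneg) auto

lemma modular_term_nonneg: "x \<in> c0 \<Gamma> \<Longrightarrow> 0 \<le> modular_term n x"
  unfolding modular_term_def
  by (intro add_nonneg_nonneg weighted_top_squares_nonneg zero_le_even_power) auto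

lemma summable_modular_term:
  assumes "x \<in> c0 \<Gamma>"
  shows "summable (\<lambda>n. modular_term n x)"
proof (rule summable_comparison_test_ev)
  let ?B = "c0_norm \<Gamma> x"
  have "\<forall>\<^sub>F n in sequentially. \<bar>x (g n)\<bar> < 1/2"
    using assms by (rule eventually_small) simp
  then show "\<forall>\<^sub>F n in sequentially. norm (modular_term n x) \<le> (1/4) ^ Suc n + (1/2) ^ Suc n * ?B\<^sup>2"
  proof eventually_elim
    case (elim n)
    then have "x (g n) ^ (2 * Suc n) \<le> (1/4) ^ Suc n"
      by (intro even_power_le) auto
    moreover have "(1/4) ^ Suc n * top_squares rest (Suc n) x \<le> (1/2) ^ Suc n * ?B\<^sup>2"
      using abs_le_c0_norm[OF assms] by (intro weighted_top_squares_le) (auto simp: rest_def)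
    ultimately show ?case
      using modular_term_nonneg[OF assms, of n] unfolding modular_term_def real_norm_def by linarith
  qed
  have geometric: "summable (\<lambda>n. r ^ Suc n)" if "\<bar>r\<bar> < 1" for r :: real
    using summable_mult[OF summable_geometric[of r], of r] that by simp
  show "summable (\<lambda>n. (1/4) ^ Suc n + (1/2) ^ Suc n * ?B\<^sup>2)"
    by (intro summable_add summable_mult2 geometric) auto
qed

lemma modular_term_le_modular:
  assumes "x \<in> c0 \<Gamma>"
  shows "modular_term n x \<le> modular x"
  unfolding modular_def
  using sum_le_suminf[OF summable_modular_term[OF assms], of "{n}"] modular_term_nonneg[OF assms]
  by simp

lemma modular_mono:
  assumes "x \<in> c0 \<Gamma>" "y \<in> c0 \<Gamma>" "\<And>\<gamma>. \<bar>x \<gamma>\<bar> \<le> \<bar>y \<gamma>\<bar>"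
  shows "modular x \<le> modular y"
  unfolding modular_def
proof (intro suminf_le summable_modular_term assms(1,2))
  show "modular_term n x \<le> modular_term n y" for n
    unfolding modular_term_def using assms bounded_rest
    by (intro add_mono mult_left_mono top_squares_mono power_mono_even) auto
qed

lemma modular_term_convex:
  assumes "x \<in> c0 \<Gamma>" "y \<in> c0 \<Gamma>" "0 \<le> u" "0 \<le> v" "u + v = 1"
  shows "modular_term n (u *\<^sub>R x + v *\<^sub>R y) \<le> u * modular_term n x + v * modular_term n y"
proof -
  have "(u * x (g n) + v * y (g n)) ^ (2 * Suc n)
      \<le> u * x (g n) ^ (2 * Suc n) + v * y (g n) ^ (2 * Suc n)"
    using assms(3-) by (rule even_power_convex)
  moreover have "(1/4) ^ Suc n * top_squares rest (Suc n) (u *\<^sub>R x + v *\<^sub>R y)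
      \<le> (1/4) ^ Suc n * (u * top_squares rest (Suc n) x + v * top_squares rest (Suc n) y)"
    using assms by (intro mult_left_mono top_squares_convex bounded_rest) auto
  ultimately show ?thesis
    unfolding modular_term_def by (simp add: scaleR_fun_def algebra_simps)
qed

lemma modular_convex:
  assumes "x \<in> c0 \<Gamma>" "y \<in> c0 \<Gamma>" "0 \<le> u" "0 \<le> v" "u + v = 1"
  shows "modular (u *\<^sub>R x + v *\<^sub>R y) \<le> u * modular x + v * modular y"
proof -
  have "modular (u *\<^sub>R x + v *\<^sub>R y) \<le> (\<Sum>n. u * modular_term n x + v * modular_term n y)"
    unfolding modular_def using assms
    by (intro suminf_le modular_term_convex summable_add summable_mult summable_modular_term
        subspace_add subspace_scale subspace_c0)
  also have "\<dots> = u * modular x + v * modular y"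
    unfolding modular_def using assms
    by (simp add: summable_mult summable_modular_term flip: suminf_add suminf_mult)
  finally show ?thesis .
qed

lemma modular_strict:
  assumes xy: "x \<in> c0 \<Gamma>" "y \<in> c0 \<Gamma>" "x \<noteq> y"
  shows "modular ((1/2) *\<^sub>R (x + y)) < (modular x + modular y) / 2"
proof -
  let ?z = "(1/2) *\<^sub>R (x + y)"
  have z: "?z \<in> c0 \<Gamma>"
    using xy by (intro subspace_add subspace_scale subspace_c0)
  \<comment> \<open>Both parts of each term are convex, so it suffices that one part of one term is strict.\<close>
  define gap where "gap n = (modular_term n x + modular_term n y) / 2 - modular_term n ?z" for n
  have split: "gap n = ((x (g n) ^ (2 * Suc n) + y (g n) ^ (2 * Suc n)) / 2
        - ((1/2) * (x (g n) + y (g n))) ^ (2 * Suc n))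
      + (1/4) ^ Suc n * ((top_squares rest (Suc n) x + top_squares rest (Suc n) y) / 2
        - top_squares rest (Suc n) ?z)" for n
    by (simp add: gap_def modular_term_def scaleR_fun_def field_simps)
  have part1: "((1/2) * (x (g n) + y (g n))) ^ (2 * Suc n)
      \<le> (x (g n) ^ (2 * Suc n) + y (g n) ^ (2 * Suc n)) / 2" for n
    using even_power_convex[of "1/2" "1/2" "x (g n)" "y (g n)" "Suc n"]
    by (simp add: add_divide_distrib)
  have part2: "top_squares rest (Suc n) ?z
      \<le> (top_squares rest (Suc n) x + top_squares rest (Suc n) y) / 2" for n
    using top_squares_convex[OF bounded_rest[OF xy(1)] bounded_rest[OF xy(2)], of "1/2" "1/2" "Suc n"]
    by (simp add: scaleR_add_right)
  have nonneg: "0 \<le> gap n" for n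
    unfolding split using part1[of n] part2[of n]
    by (intro add_nonneg_nonneg mult_nonneg_nonneg) auto
  obtain \<gamma> where \<gamma>: "x \<gamma> \<noteq> y \<gamma>" using xy(3) by auto
  then have "\<gamma> \<in> \<Gamma>" using c0_vanishes[OF xy(1)] c0_vanishes[OF xy(2)] by metis
  then consider n where "\<gamma> = g n" | "\<gamma> \<in> rest" by (auto simp: rest_def)
  then have "\<exists>n. 0 < gap n"
  proof cases
    case (1 n)
    then have "((1/2) * (x (g n) + y (g n))) ^ (2 * Suc n)
        < (x (g n) ^ (2 * Suc n) + y (g n) ^ (2 * Suc n)) / 2"
      using \<gamma> by (intro even_power_strictly_convex) auto
    then have "0 < gap n"
      unfolding split using part2[of n] by (intro add_pos_nonneg mult_nonneg_nonneg) auto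
    then show ?thesis ..
  next
    case 2
    obtain n where "top_squares rest (Suc n) ?z
        < (top_squares rest (Suc n) x + top_squares rest (Suc n) y) / 2"
      using top_squares_strict[OF bounded_rest[OF xy(1)] finite_rest_large[OF xy(1)]
          bounded_rest[OF xy(2)] finite_rest_large[OF xy(2)] 2 \<gamma>] by blast
    then have "0 < gap n"
      unfolding split using part1[of n] by (intro add_nonneg_pos mult_pos_pos) auto
    then show ?thesis ..
  qed
  then obtain n where n: "0 < gap n" ..
  have "gap sums ((modular x + modular y) / 2 - modular ?z)"
    unfolding gap_def modular_def using xy(1,2) z
    by (intro sums_diff sums_divide sums_add summable_sums summable_modular_term)
  then have "(modular x + modular y) / 2 - modular ?z = suminf gap" "summable gap"
    by (auto simp: sums_iff)
  moreover have "0 < suminf gap"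
    using \<open>summable gap\<close> nonneg n by (rule suminf_pos2)
  ultimately show ?thesis by linarith
qed

lemma modular_le_1:
  assumes x: "x \<in> c0 \<Gamma>" and "\<And>\<gamma>. \<bar>x \<gamma>\<bar> \<le> 1/2"
  shows "modular x \<le> 1"
proof -
  have "modular_term n x \<le> (1/2) ^ Suc n" for n
  proof -
    have "x (g n) ^ (2 * Suc n) \<le> (1/4) ^ Suc n"
      using assms(2) by (rule even_power_le)
    also have "(1/4::real) ^ Suc n = (1/2) ^ Suc n * (1/2) ^ Suc n"
      by (simp flip: power_mult_distrib)
    also have "\<dots> \<le> (1/2) ^ Suc n * (1/2)"
      using power_decreasing[of 1 "Suc n" "1/2::real"] by (intro mult_left_mono) auto
    finally have "x (g n) ^ (2 * Suc n) \<le> (1/2) ^ Suc n * (1/2)" .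
    moreover have "(1/4) ^ Suc n * top_squares rest (Suc n) x \<le> (1/2) ^ Suc n * (1/2)\<^sup>2"
      using assms(2) by (rule weighted_top_squares_le)
    moreover have "(1/2::real) ^ Suc n * (1/2)\<^sup>2 \<le> (1/2) ^ Suc n * (1/2)"
      by (simp add: power2_eq_square)
    ultimately show ?thesis unfolding modular_term_def by linarith
  qed
  then have "modular x \<le> (\<Sum>n. (1/2) ^ Suc n)"
    unfolding modular_def using power_half_series sums_summable
    by (intro suminf_le summable_modular_term x) blast
  then show ?thesis using sums_unique[OF power_half_series] by simp
qed

text \<open>
  A coordinate at \<open>g n\<close> is seen by the power in the \<open>n\<close>-th term. Any other coordinate in \<open>\<Gamma>\<close> is
  seen by the supremum over singletons in the term with index \<open>0\<close>; its weight \<open>1/4\<close> leads to the bound \<open>2\<close>.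
\<close>

lemma abs_le_2_if_modular_le_1:
  assumes x: "x \<in> c0 \<Gamma>" and le: "modular x \<le> 1"
  shows "\<bar>x \<gamma>\<bar> \<le> 2"
proof -
  consider n where "\<gamma> = g n" | "\<gamma> \<in> rest" | "\<gamma> \<notin> \<Gamma>" by (auto simp: rest_def)
  then show ?thesis
  proof cases
    case (1 n)
    have "x (g n) ^ (2 * Suc n) \<le> modular_term n x"
      using weighted_top_squares_nonneg[OF x, of n] by (simp add: modular_term_def)
    also have "\<dots> \<le> 1" using modular_term_le_modular[OF x, of n] le by simp
    finally have "\<bar>x (g n)\<bar> ^ (2 * Suc n) \<le> 1" by (simp add: power_even_abs)
    then have "\<bar>x (g n)\<bar> \<le> 1"
      using one_less_power[of "\<bar>x (g n)\<bar>" "2 * Suc n"] by (meson not_le zero_less_Suc mult_pos_pos zero_less_numeral)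
    then show ?thesis using 1 by simp
  next
    case 2
    have "(x \<gamma>)\<^sup>2 \<le> top_squares rest (Suc 0) x"
      using sum_le_top_squares[OF bounded_rest[OF x], of "{\<gamma>}" "Suc 0"] 2 by simp
    also have "\<dots> \<le> 4 * modular_term 0 x" by (simp add: modular_term_def)
    also have "\<dots> \<le> 2\<^sup>2" using modular_term_le_modular[OF x, of 0] le by simp
    finally show ?thesis using abs_le_square_iff[of "x \<gamma>" 2] by simp
  next
    case 3
    then show ?thesis using c0_vanishes[OF x] by simp
  qed
qed

text \<open>
  Changing the coordinate at \<open>g n\<close> affects a single term of the modular, and there only the power.
\<close>

lemma modular_change_coordinate:
  assumes "x \<in> c0 \<Gamma>" "y \<in> c0 \<Gamma>" "\<And>\<gamma>. \<gamma> \<noteq> g n \<Longrightarrow> y \<gamma> = x \<gamma>"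
  shows "modular y \<le> modular x + y (g n) ^ (2 * Suc n)"
proof -
  let ?p = "\<lambda>m. if m = n then y (g n) ^ (2 * Suc n) else 0"
  have same: "top_squares rest k y = top_squares rest k x" for k
    using assms(3) g_not_rest by (intro top_squares_cong) metis
  have "modular_term m y \<le> modular_term m x + ?p m" for m
  proof (cases "m = n")
    case True
    have "0 \<le> x (g n) ^ (2 * Suc n)" by (intro zero_le_even_power) auto
    then show ?thesis using True same by (simp add: modular_term_def)
  next
    case False
    then have "y (g m) = x (g m)" using assms(3) inj by (simp add: inj_eq)
    then show ?thesis using False same by (simp add: modular_term_def)
  qed
  moreover have "?p sums y (g n) ^ (2 * Suc n)" by (rule sums_single)
  ultimately show ?thesis
    unfolding modular_def using assms(1,2)
    by (intro sums_le[OF _ summable_sums sums_add[OF summable_sums]] summable_modular_term)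
qed

lemma modular_zero: "modular 0 = 0"
proof (rule antisym)
  have "modular_term n 0 \<le> 0" for n
  proof -
    have "(1/4) ^ Suc n * top_squares rest (Suc n) (0 :: 'a \<Rightarrow> real) \<le> (1/2) ^ Suc n * 0\<^sup>2"
      by (rule weighted_top_squares_le) simp
    moreover have "(0 :: real) ^ (2 * Suc n) = 0" by simp
    ultimately show ?thesis unfolding modular_term_def zero_fun_def by simp
  qed
  then have "modular 0 \<le> (\<Sum>n. 0)"
    unfolding modular_def
    by (intro suminf_le summable_modular_term subspace_0 subspace_c0) auto
  then show "modular 0 \<le> 0" by simp
  show "0 \<le> modular 0"
    unfolding modular_def
    by (intro suminf_nonneg summable_modular_term modular_term_nonneg subspace_0 subspace_c0)
qed

sublocale convex_modular "c0 \<Gamma>" modular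
proof
  show "subspace (c0 \<Gamma>)" by (rule subspace_c0)
  show "convex_on (c0 \<Gamma>) modular"
    unfolding convex_on_def
    using modular_convex subspace_imp_convex[OF subspace_c0] by blast
  show "modular 0 = 0" by (rule modular_zero)
next
  fix x assume x: "x \<in> c0 \<Gamma>"
  then have "- x \<in> c0 \<Gamma>" by (rule subspace_neg[OF subspace_c0])
  with x show "modular (- x) = modular x"
    by (intro antisym modular_mono) auto
next
  fix x :: "'a \<Rightarrow> real" assume x: "x \<in> c0 \<Gamma>" "x \<noteq> 0"
  then obtain \<gamma> where \<gamma>: "x \<gamma> \<noteq> 0" by (auto simp: fun_eq_iff)
  show "\<exists>r>0. 1 < modular (r *\<^sub>R x)"
  proof (intro exI conjI)
    show "0 < 3 / \<bar>x \<gamma>\<bar>" using \<gamma> by simp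
    have "\<bar>((3 / \<bar>x \<gamma>\<bar>) *\<^sub>R x) \<gamma>\<bar> = 3" using \<gamma> by (simp add: scaleR_fun_def abs_mult)
    then show "1 < modular ((3 / \<bar>x \<gamma>\<bar>) *\<^sub>R x)"
      using abs_le_2_if_modular_le_1[OF subspace_scale[OF subspace_c0 x(1)], of "3 / \<bar>x \<gamma>\<bar>" \<gamma>]
      by linarith
  qed
qed

lemma luxemburg_mono:
  assumes "x \<in> c0 \<Gamma>" "y \<in> c0 \<Gamma>" "\<And>\<gamma>. \<bar>x \<gamma>\<bar> \<le> \<bar>y \<gamma>\<bar>"
  shows "luxemburg x \<le> luxemburg y"
proof (rule field_le_epsilon)
  fix e :: real assume e: "0 < e"
  let ?r = "luxemburg y + e"
  have r: "0 < ?r" using luxemburg_nonneg[OF assms(2)] e by simp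
  have "modular (x /\<^sub>R ?r) \<le> modular (y /\<^sub>R ?r)"
    using assms r by (intro modular_mono scale_mem) (auto simp: scaleR_fun_def abs_mult intro: mult_left_mono)
  also have "\<dots> \<le> 1" using luxemburg_le_iff[OF assms(2) r] e by simp
  finally show "luxemburg x \<le> ?r" using r by (intro luxemburg_le)
qed

theorem equivalent_luxemburg: "equivalent_norms_on (c0 \<Gamma>) luxemburg (c0_norm \<Gamma>)"
proof -
  have "(1/2) * c0_norm \<Gamma> x \<le> luxemburg x \<and> luxemburg x \<le> 2 * c0_norm \<Gamma> x"
    if x: "x \<in> c0 \<Gamma>" for x
  proof (cases "x = 0")
    case True
    moreover have "c0_norm \<Gamma> 0 = 0"
      using norm_on_c0[OF nonempty] subspace_0[OF subspace_c0] unfolding norm_on_def by blast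
    ultimately show ?thesis by (simp add: luxemburg_zero)
  next
    case False
    let ?M = "c0_norm \<Gamma> x" and ?r = "luxemburg x"
    have pos: "0 < ?M" "0 < ?r"
      using False x luxemburg_eq_0_iff[OF x] luxemburg_nonneg[OF x] norm_on_c0[OF nonempty]
      unfolding norm_on_def by (auto simp: less_le)
    have le_M: "\<bar>x \<gamma>\<bar> \<le> ?M" for \<gamma>
      using abs_le_c0_norm[OF x, of \<gamma>] c0_vanishes[OF x, of \<gamma>] pos by (cases "\<gamma> \<in> \<Gamma>") auto
    have "modular (x /\<^sub>R (2 * ?M)) \<le> 1"
      using pos le_M by (intro modular_le_1 scale_mem x) (auto simp: scaleR_fun_def abs_mult field_simps)
    then have "luxemburg x \<le> 2 * ?M"
      using pos by (intro luxemburg_le) auto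
    moreover have "modular (x /\<^sub>R ?r) \<le> 1"
      using luxemburg_le_iff[OF x pos(2)] by simp
    then have "\<bar>(x /\<^sub>R ?r) \<gamma>\<bar> \<le> 2" for \<gamma>
      by (intro abs_le_2_if_modular_le_1 scale_mem x)
    then have "\<bar>x \<gamma>\<bar> \<le> 2 * ?r" for \<gamma>
      using pos by (simp add: scaleR_fun_def abs_mult field_simps)
    then have "?M \<le> 2 * ?r"
      by (intro c0_norm_le nonempty)
    ultimately show ?thesis by simp
  qed
  moreover have "0 < (1/2 :: real)" "0 < (2 :: real)" by auto
  ultimately show ?thesis
    unfolding equivalent_norms_on_def using norm_on_luxemburg norm_on_c0[OF nonempty] by blast
qed

lemma luxemburg_unit_vector: "luxemburg (indicator {g n}) = 1"
proof -
  let ?y = "indicator {g n} :: 'a \<Rightarrow> real"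
  have y: "?y \<in> c0 \<Gamma>"
    using g_mem by (rule unit_vector_mem_c0)
  have "modular ?y \<le> modular 0 + ?y (g n) ^ (2 * Suc n)"
    using y by (intro modular_change_coordinate subspace_0 subspace_c0) auto
  then have "modular ?y \<le> 1" by (simp add: modular_zero)
  moreover have "1 \<le> modular_term n ?y"
    using weighted_top_squares_nonneg[OF y, of n] by (simp add: modular_term_def)
  then have "1 \<le> modular ?y" using modular_term_le_modular[OF y, of n] by simp
  ultimately show ?thesis
    using luxemburg_le_iff[OF y, of 1] luxemburg_less_iff[OF y, of 1] by simp
qed

text \<open>
  The witness is the unit vector at \<open>g n\<close> for a large \<open>n\<close>. All finitely many given vectors are then
  smaller than \<open>\<epsilon>/2\<close> at \<open>g n\<close>, so after division by \<open>1 + \<epsilon>\<close> the coordinate of the sum has absolute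
  value at most \<open>(1 + \<epsilon>/2) / (1 + \<epsilon>) < 1\<close>, and its power tends to \<open>0\<close> as \<open>n\<close> grows.
\<close>

theorem almost_square_luxemburg: "almost_square_on (c0 \<Gamma>) luxemburg"
  unfolding almost_square_on_def
proof (intro allI impI)
  fix S :: "('a \<Rightarrow> real) set" and \<epsilon> :: real
  assume S: "finite S \<and> S \<subseteq> unit_sphere_on (c0 \<Gamma>) luxemburg" and \<epsilon>: "0 < \<epsilon>"
  define q where "q = (1 + \<epsilon>/2) / (1 + \<epsilon>)"
  have q: "0 \<le> q" "q < 1" using \<epsilon> by (auto simp: q_def)
  have "\<forall>\<^sub>F n in sequentially. q ^ n < \<epsilon> / (1 + \<epsilon>)"
    using LIMSEQ_power_zero[of q] q \<epsilon> by (intro order_tendstoD(2)) auto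
  moreover have "\<forall>\<^sub>F n in sequentially. \<forall>x\<in>S. \<bar>x (g n)\<bar> < \<epsilon>/2"
    using S \<epsilon> by (intro eventually_ball_finite ballI eventually_small) (auto simp: unit_sphere_on_def)
  ultimately have "\<forall>\<^sub>F n in sequentially. q ^ n < \<epsilon> / (1 + \<epsilon>) \<and> (\<forall>x\<in>S. \<bar>x (g n)\<bar> < \<epsilon>/2)"
    by (rule eventually_conj)
  then obtain n where n: "q ^ n < \<epsilon> / (1 + \<epsilon>)" "\<And>x. x \<in> S \<Longrightarrow> \<bar>x (g n)\<bar> < \<epsilon>/2"
    by (auto dest!: eventually_happens)
  let ?y = "indicator {g n} :: 'a \<Rightarrow> real"
  have y: "?y \<in> c0 \<Gamma>"
    using g_mem by (rule unit_vector_mem_c0)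
  show "\<exists>y\<in>unit_sphere_on (c0 \<Gamma>) luxemburg. \<forall>x\<in>S. luxemburg (x + y) \<le> 1 + \<epsilon>"
  proof (intro bexI ballI)
    show "?y \<in> unit_sphere_on (c0 \<Gamma>) luxemburg"
      using y luxemburg_unit_vector by (simp add: unit_sphere_on_def)
    fix x assume "x \<in> S"
    then have x: "x \<in> c0 \<Gamma>" "luxemburg x = 1" using S by (auto simp: unit_sphere_on_def)
    let ?z = "(x + ?y) /\<^sub>R (1 + \<epsilon>)"
    have "\<bar>?z (g n)\<bar> \<le> q"
    proof -
      have "?z (g n) = (x (g n) + 1) / (1 + \<epsilon>)"
        by (simp add: scaleR_fun_def divide_inverse mult.commute)
      moreover have "\<bar>x (g n) + 1\<bar> \<le> 1 + \<epsilon>/2"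
        using n(2)[OF \<open>x \<in> S\<close>] by linarith
      ultimately show ?thesis
        using \<epsilon> by (simp add: q_def abs_divide divide_right_mono)
    qed
    then have "?z (g n) ^ (2 * Suc n) \<le> q ^ (2 * Suc n)"
      using q by (intro power_mono_even) auto
    also have "\<dots> \<le> q ^ n" using q by (intro power_decreasing) auto
    finally have zn: "?z (g n) ^ (2 * Suc n) \<le> \<epsilon> / (1 + \<epsilon>)" using n(1) by simp
    have "modular x \<le> 1" using luxemburg_le_iff[OF x(1), of 1] x(2) by simp
    have "modular (x /\<^sub>R (1 + \<epsilon>)) \<le> inverse (1 + \<epsilon>) * modular x"
      using \<epsilon> by (intro scale_le x) (auto simp: field_simps)
    also have "\<dots> \<le> inverse (1 + \<epsilon>) * 1"
      using \<epsilon> \<open>modular x \<le> 1\<close> by (intro mult_left_mono) auto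
    finally have "modular (x /\<^sub>R (1 + \<epsilon>)) \<le> 1 / (1 + \<epsilon>)"
      by (simp add: inverse_eq_divide)
    moreover have "modular ?z \<le> modular (x /\<^sub>R (1 + \<epsilon>)) + ?z (g n) ^ (2 * Suc n)"
      using x y by (intro modular_change_coordinate scale_mem add_mem) (auto simp: scaleR_fun_def)
    ultimately have "modular ?z \<le> 1 / (1 + \<epsilon>) + \<epsilon> / (1 + \<epsilon>)" using zn by linarith
    also have "\<dots> = 1" using \<epsilon> by (simp flip: add_divide_distrib)
    finally show "luxemburg (x + ?y) \<le> 1 + \<epsilon>"
      using \<epsilon> by (intro luxemburg_le) auto
  qed
qed

end

section \<open>Unit vectors as a basis for lattice norms\<close>

lemma sum_unit_vectors:
  assumes "finite F"
  shows "(\<Sum>i\<in>F. a i *\<^sub>R (indicator {i} :: 'a \<Rightarrow> real)) = (\<lambda>\<gamma>. if \<gamma> \<in> F then a \<gamma> else 0)"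
  using assms
  by (induction F rule: finite_induct) (auto simp: fun_eq_iff scaleR_fun_def indicator_def)

text \<open>
  Equivalence with the supremum norm makes the coordinates continuous, which gives uniqueness of
  the coefficients, and lets finite partial sums approximate \<open>x\<close> once they contain all
  large coordinates. Monotonicity in the absolute values is the constant \<open>1\<close>.
\<close>

lemma one_unconditional_unit_vectors:
  fixes N :: "('a \<Rightarrow> real) \<Rightarrow> real"
  assumes "\<Gamma> \<noteq> {}"
    and equivalent: "equivalent_norms_on (c0 \<Gamma>) N (c0_norm \<Gamma>)"
    and mono: "\<And>x y. x \<in> c0 \<Gamma> \<Longrightarrow> y \<in> c0 \<Gamma> \<Longrightarrow> (\<And>\<gamma>. \<bar>x \<gamma>\<bar> \<le> \<bar>y \<gamma>\<bar>) \<Longrightarrow> N x \<le> N y"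
  shows "one_unconditional_basis_on (c0 \<Gamma>) N \<Gamma> (\<lambda>\<gamma>. indicator {\<gamma>})"
proof -
  let ?e = "\<lambda>\<gamma>. indicator {\<gamma>} :: 'a \<Rightarrow> real"
  obtain c C where c: "0 < c" "\<And>x. x \<in> c0 \<Gamma> \<Longrightarrow> c * c0_norm \<Gamma> x \<le> N x"
    and C: "0 < C" "\<And>x. x \<in> c0 \<Gamma> \<Longrightarrow> N x \<le> C * c0_norm \<Gamma> x"
    using equivalent unfolding equivalent_norms_on_def by blast
  have sum_mem: "(\<Sum>i\<in>F. a i *\<^sub>R ?e i) \<in> c0 \<Gamma>" if "finite F" "F \<subseteq> \<Gamma>" for F a
    unfolding sum_unit_vectors[OF that(1)] using that by (intro finite_support_mem_c0[of F]) auto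
  have expansion: "unconditional_sum_on N \<Gamma> ?e (restrict x \<Gamma>) x" if x: "x \<in> c0 \<Gamma>" for x
    unfolding unconditional_sum_on_def
  proof (intro allI impI)
    fix \<epsilon> :: real assume \<epsilon>: "0 < \<epsilon>"
    define d where "d = \<epsilon> / (2 * C)"
    have d: "0 < d" using \<epsilon> C by (simp add: d_def)
    let ?F = "{\<gamma>\<in>\<Gamma>. d \<le> \<bar>x \<gamma>\<bar>}"
    have "N (x - (\<Sum>i\<in>G. restrict x \<Gamma> i *\<^sub>R ?e i)) < \<epsilon>"
      if G: "finite G" "?F \<subseteq> G" "G \<subseteq> \<Gamma>" for G
    proof -
      let ?r = "x - (\<Sum>i\<in>G. restrict x \<Gamma> i *\<^sub>R ?e i)"
      have r: "?r \<in> c0 \<Gamma>"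
        using x sum_mem G by (intro subspace_diff subspace_c0) auto
      have "c0_norm \<Gamma> ?r \<le> d"
        using assms(1) G d unfolding sum_unit_vectors[OF G(1)] by (intro c0_norm_le) auto
      then have "C * c0_norm \<Gamma> ?r \<le> C * d" using C by (intro mult_left_mono) auto
      also have "\<dots> < \<epsilon>" using C \<epsilon> by (simp add: d_def)
      finally show ?thesis using C(2)[OF r] by simp
    qed
    then show "\<exists>F. finite F \<and> F \<subseteq> \<Gamma> \<and> (\<forall>G. finite G \<and> F \<subseteq> G \<and> G \<subseteq> \<Gamma> \<longrightarrow>
        N (x - (\<Sum>i\<in>G. restrict x \<Gamma> i *\<^sub>R ?e i)) < \<epsilon>)"
      using finite_c0_large[OF x d] by (intro exI[of _ ?F]) auto
  qed
  have unique: "a = restrict x \<Gamma>"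
    if x: "x \<in> c0 \<Gamma>" and a: "a \<in> \<Gamma> \<rightarrow>\<^sub>E UNIV" "unconditional_sum_on N \<Gamma> ?e a x" for a x
  proof -
    have "a \<gamma> = x \<gamma>" if \<gamma>: "\<gamma> \<in> \<Gamma>" for \<gamma>
    proof -
      have "\<bar>x \<gamma> - a \<gamma>\<bar> \<le> 0 + \<epsilon>" if \<epsilon>: "0 < \<epsilon>" for \<epsilon>
      proof -
        have "0 < c * \<epsilon>" using c \<epsilon> by simp
        from a(2)[unfolded unconditional_sum_on_def, rule_format, OF this]
        obtain F where F: "finite F" "F \<subseteq> \<Gamma>"
          "\<forall>G. finite G \<and> F \<subseteq> G \<and> G \<subseteq> \<Gamma> \<longrightarrow> N (x - (\<Sum>i\<in>G. a i *\<^sub>R ?e i)) < c * \<epsilon>"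
          by blast
        let ?G = "insert \<gamma> F"
        let ?r = "x - (\<Sum>i\<in>?G. a i *\<^sub>R ?e i)"
        have G: "finite ?G" "?G \<subseteq> \<Gamma>" using F \<gamma> by auto
        have r: "?r \<in> c0 \<Gamma>"
          using x sum_mem[OF G] by (intro subspace_diff subspace_c0)
        have "?r \<gamma> = x \<gamma> - a \<gamma>"
          unfolding sum_unit_vectors[OF G(1)] by simp
        then have "c * \<bar>x \<gamma> - a \<gamma>\<bar> \<le> c * c0_norm \<Gamma> ?r"
          using abs_le_c0_norm[OF r \<gamma>] c by simp
        also have "\<dots> \<le> N ?r" by (rule c(2)[OF r])
        also have "\<dots> < c * \<epsilon>" using F(3)[rule_format, of ?G] G by blast
        finally show ?thesis using c by simp
      qed
      then have "\<bar>x \<gamma> - a \<gamma>\<bar> \<le> 0" by (rule field_le_epsilon)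
      then show ?thesis by simp
    qed
    then show ?thesis
      using a(1) by (auto simp: fun_eq_iff restrict_def PiE_def extensional_def)
  qed
  have ex1: "\<exists>!a. a \<in> \<Gamma> \<rightarrow>\<^sub>E (UNIV :: real set) \<and> unconditional_sum_on N \<Gamma> ?e a x"
    if x: "x \<in> c0 \<Gamma>" for x
    using expansion[OF x] unique[OF x] by (intro ex1I[of _ "restrict x \<Gamma>"]) auto
  have mem: "?e ` \<Gamma> \<subseteq> c0 \<Gamma>"
    by (intro image_subsetI unit_vector_mem_c0)
  have le: "N (\<Sum>i\<in>F. b i *\<^sub>R ?e i) \<le> N (\<Sum>i\<in>F. a i *\<^sub>R ?e i)"
    if "finite F" "F \<subseteq> \<Gamma>" "\<forall>i\<in>F. \<bar>b i\<bar> \<le> \<bar>a i\<bar>" for F a b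
    using that sum_mem by (intro mono) (auto simp: sum_unit_vectors)
  show ?thesis
    unfolding one_unconditional_basis_on_def unconditional_basis_on_def
    by (intro conjI allI ballI impI assms(1) mem ex1 le) simp_all
qed

theorem corollary5p5:
  fixes \<Gamma> :: "'a set"
  assumes "infinite \<Gamma>"
  shows "\<exists>N :: ('a \<Rightarrow> real) \<Rightarrow> real.
    equivalent_norms_on (c0 \<Gamma>) N (c0_norm \<Gamma>) \<and>
    strictly_convex_norm_on (c0 \<Gamma>) N \<and>
    almost_square_on (c0 \<Gamma>) N \<and>
    (\<exists>(A :: 'a set) (e :: 'a \<Rightarrow> 'a \<Rightarrow> real). one_unconditional_basis_on (c0 \<Gamma>) N A e)"
proof -
  obtain g :: "nat \<Rightarrow> 'a" where g: "inj g" "range g \<subseteq> \<Gamma>"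
    using infinite_countable_subset[OF assms] by blast
  interpret c0_with_sequence \<Gamma> g
    using g by unfold_locales
  have "one_unconditional_basis_on (c0 \<Gamma>) luxemburg \<Gamma> (\<lambda>\<gamma>. indicator {\<gamma>})"
    using nonempty equivalent_luxemburg luxemburg_mono by (rule one_unconditional_unit_vectors)
  then show ?thesis
    using equivalent_luxemburg strictly_convex_luxemburg[OF modular_strict] almost_square_luxemburg
    by blast
qed

end
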